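(* Let $p\ge1$ be an integer, let $\alpha,\beta\ge 0$ be real numbers, and let $\nu_1,\nu_2,\nu_3$ be positive rational numbers. Let $f^{p,\alpha,\beta}:[-\pi,\pi]^3\to\mathbb{C}^{3\times3}$ be the Hermitian matrix-valued function defined in the context, with eigenvalues $\lambda_i(f^{p,\alpha,\beta}(\theta_1,\theta_2,\theta_3))$, $i=1,2,3$, and let $\mathfrak{L}_p$ be the 3D Laplacian symbol defined in the context. Then, for all $(\theta_1,\theta_2,\theta_3)\in[-\pi,\pi]^3$, $$0\le\min(\alpha,\beta)\,\mathfrak{L}_p(\theta_1,\theta_2,\theta_3)\le\lambda_i(f^{p,\alpha,\beta}(\theta_1,\theta_2,\theta_3))\le\max(\alpha,\beta)\,\mathfrak{L}_p(\theta_1,\theta_2,\theta_3),\qquad i=1,2,3.$$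
   Context: **Cardinal B-splines.** $\phi_0(t)=1$ for $t\in[0,1)$ and $0$ otherwise; for $p\ge1$, $\phi_p(t)=\frac{t}{p}\phi_{p-1}(t)+\frac{p+1-t}{p}\phi_{p-1}(t-1)$. **Univariate symbols.** For $\theta\in[-\pi,\pi]$, $$\mathfrak{m}_p(\theta)=\phi_{2p+1}(p+1)+2\sum_{k=1}^p\phi_{2p+1}(p+1-k)\cos(k\theta),$$ $$\mathfrak{a}_p(\theta)=-2\sum_{k=1}^p\phi_{2p+1}'(p+1-k)\sin(k\theta),$$ $$\mathfrak{s}_p(\theta)=-\phi_{2p+1}''(p+1)-2\sum_{k=1}^p\phi_{2p+1}''(p+1-k)\cos(k\theta).$$ **3D symbol.** Let $\gamma_i=\nu_i^2/(\nu_1\nu_2\nu_3)$ and $\delta_i=1/\nu_i$, $i=1,2,3$. The function $f^{p,\alpha,\beta}=[f^{p,\alpha,\beta}_{i,j}]_{i,j=1}^3$ has entries at $(\theta_1,\theta_2,\theta_3)$ $$f_{1,1}^{p,\alpha,\beta}=\beta\gamma_1\mathfrak{s}_p(\theta_1)\mathfrak{m}_p(\theta_2)\mathfrak{m}_p(\theta_3)+\alpha\gamma_2\mathfrak{m}_p(\theta_1)\mathfrak{s}_p(\theta_2)\mathfrak{m}_p(\theta_3)+\alpha\gamma_3\mathfrak{m}_p(\theta_1)\mathfrak{m}_p(\theta_2)\mathfrak{s}_p(\theta_3),$$ $$f_{2,2}^{p,\alpha,\beta}=\alpha\gamma_1\mathfrak{s}_p(\theta_1)\mathfrak{m}_p(\theta_2)\mathfrak{m}_p(\theta_3)+\beta\gamma_2\mathfrak{m}_p(\theta_1)\mathfrak{s}_p(\theta_2)\mathfrak{m}_p(\theta_3)+\alpha\gamma_3\mathfrak{m}_p(\theta_1)\mathfrak{m}_p(\theta_2)\mathfrak{s}_p(\theta_3),$$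 $$f_{3,3}^{p,\alpha,\beta}=\alpha\gamma_1\mathfrak{s}_p(\theta_1)\mathfrak{m}_p(\theta_2)\mathfrak{m}_p(\theta_3)+\alpha\gamma_2\mathfrak{m}_p(\theta_1)\mathfrak{s}_p(\theta_2)\mathfrak{m}_p(\theta_3)+\beta\gamma_3\mathfrak{m}_p(\theta_1)\mathfrak{m}_p(\theta_2)\mathfrak{s}_p(\theta_3),$$ $$f_{1,2}^{p,\alpha,\beta}=f_{2,1}^{p,\alpha,\beta}=-(\alpha-\beta)\delta_3\,\mathfrak{a}_p(\theta_1)\mathfrak{a}_p(\theta_2)\mathfrak{m}_p(\theta_3),$$ $$f_{1,3}^{p,\alpha,\beta}=f_{3,1}^{p,\alpha,\beta}=-(\alpha-\beta)\delta_2\,\mathfrak{a}_p(\theta_1)\mathfrak{m}_p(\theta_2)\mathfrak{a}_p(\theta_3),$$ $$f_{2,3}^{p,\alpha,\beta}=f_{3,2}^{p,\alpha,\beta}=-(\alpha-\beta)\delta_1\,\mathfrak{m}_p(\theta_1)\mathfrak{a}_p(\theta_2)\mathfrak{a}_p(\theta_3).$$ **3D Laplacian symbol.** $$\mathfrak{L}_p(\theta_1,\theta_2,\theta_3)=\gamma_1\mathfrak{s}_p(\theta_1)\mathfrak{m}_p(\theta_2)\mathfrak{m}_p(\theta_3)+\gamma_2\mathfrak{m}_p(\theta_1)\mathfrak{s}_p(\theta_2)\mathfrak{m}_p(\theta_3)+\gamma_3\mathfrak{m}_p(\theta_1)\mathfrak{m}_p(\theta_2)\mathfrak{s}_p(\theta_3).$$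 *)

theory Defs
  imports "HOL-Analysis.Derivative" "Jordan_Normal_Form.Char_Poly"
begin

primrec cardinal_bspline :: "nat \<Rightarrow> real \<Rightarrow> real" where
  "cardinal_bspline 0 = (\<lambda>t. if 0 \<le> t \<and> t < 1 then 1 else 0)"
| "cardinal_bspline (Suc q) = (\<lambda>t.
     t / real (Suc q) * cardinal_bspline q t
     + (real (Suc q) + 1 - t) / real (Suc q) * cardinal_bspline q (t - 1))"

definition mass_symbol :: "nat \<Rightarrow> real \<Rightarrow> real" where
  "mass_symbol p \<theta> =
     cardinal_bspline (2*p+1) (real p + 1)
     + 2 * (\<Sum>k=1..p. cardinal_bspline (2*p+1) (real p + 1 - real k) * cos (real k * \<theta>))"

definition advection_symbol :: "nat \<Rightarrow> real \<Rightarrow> real" where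
  "advection_symbol p \<theta> =
     - 2 * (\<Sum>k=1..p. deriv (cardinal_bspline (2*p+1)) (real p + 1 - real k) * sin (real k * \<theta>))"

text \<open>For \<^term>\<open>p \<ge> 1\<close> the spline of degree \<^term>\<open>2*p+1\<close> is twice continuously
  differentiable, so the iterated \<^const>\<open>deriv\<close> is the classical second derivative.\<close>

definition stiffness_symbol :: "nat \<Rightarrow> real \<Rightarrow> real" where
  "stiffness_symbol p \<theta> =
     - deriv (deriv (cardinal_bspline (2*p+1))) (real p + 1)
     - 2 * (\<Sum>k=1..p. deriv (deriv (cardinal_bspline (2*p+1))) (real p + 1 - real k)
                        * cos (real k * \<theta>))"

text \<open>A triple \<open>(\<nu>\<^sub>1, \<nu>\<^sub>2, \<nu>\<^sub>3)\<close> is a function on \<^typ>\<open>nat\<close>, of which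
  only the values at 1, 2, 3 are used.\<close>

definition gamma_coeff :: "(nat \<Rightarrow> real) \<Rightarrow> nat \<Rightarrow> real" where
  "gamma_coeff \<nu> i = (\<nu> i)\<^sup>2 / (\<nu> 1 * \<nu> 2 * \<nu> 3)"

definition delta_coeff :: "(nat \<Rightarrow> real) \<Rightarrow> nat \<Rightarrow> real" where
  "delta_coeff \<nu> i = 1 / \<nu> i"

definition symbol_matrix ::
  "nat \<Rightarrow> real \<Rightarrow> real \<Rightarrow> (nat \<Rightarrow> real) \<Rightarrow> real \<Rightarrow> real \<Rightarrow> real \<Rightarrow> complex mat" where
  "symbol_matrix p \<alpha> \<beta> \<nu> \<theta>\<^sub>1 \<theta>\<^sub>2 \<theta>\<^sub>3 =
    (let m = mass_symbol p; a = advection_symbol p; s = stiffness_symbol p;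
         \<gamma> = gamma_coeff \<nu>; \<delta> = delta_coeff \<nu>;
         f11 = \<beta> * \<gamma> 1 * s \<theta>\<^sub>1 * m \<theta>\<^sub>2 * m \<theta>\<^sub>3 + \<alpha> * \<gamma> 2 * m \<theta>\<^sub>1 * s \<theta>\<^sub>2 * m \<theta>\<^sub>3
               + \<alpha> * \<gamma> 3 * m \<theta>\<^sub>1 * m \<theta>\<^sub>2 * s \<theta>\<^sub>3;
         f22 = \<alpha> * \<gamma> 1 * s \<theta>\<^sub>1 * m \<theta>\<^sub>2 * m \<theta>\<^sub>3 + \<beta> * \<gamma> 2 * m \<theta>\<^sub>1 * s \<theta>\<^sub>2 * m \<theta>\<^sub>3
               + \<alpha> * \<gamma> 3 * m \<theta>\<^sub>1 * m \<theta>\<^sub>2 * s \<theta>\<^sub>3;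
         f33 = \<alpha> * \<gamma> 1 * s \<theta>\<^sub>1 * m \<theta>\<^sub>2 * m \<theta>\<^sub>3 + \<alpha> * \<gamma> 2 * m \<theta>\<^sub>1 * s \<theta>\<^sub>2 * m \<theta>\<^sub>3
               + \<beta> * \<gamma> 3 * m \<theta>\<^sub>1 * m \<theta>\<^sub>2 * s \<theta>\<^sub>3;
         f12 = - (\<alpha> - \<beta>) * \<delta> 3 * a \<theta>\<^sub>1 * a \<theta>\<^sub>2 * m \<theta>\<^sub>3;
         f13 = - (\<alpha> - \<beta>) * \<delta> 2 * a \<theta>\<^sub>1 * m \<theta>\<^sub>2 * a \<theta>\<^sub>3;
         f23 = - (\<alpha> - \<beta>) * \<delta> 1 * m \<theta>\<^sub>1 * a \<theta>\<^sub>2 * a \<theta>\<^sub>3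
     in map_mat complex_of_real
          (mat_of_rows_list 3 [[f11, f12, f13],
                               [f12, f22, f23],
                               [f13, f23, f33]]))"

definition laplacian_symbol :: "nat \<Rightarrow> (nat \<Rightarrow> real) \<Rightarrow> real \<Rightarrow> real \<Rightarrow> real \<Rightarrow> real" where
  "laplacian_symbol p \<nu> \<theta>\<^sub>1 \<theta>\<^sub>2 \<theta>\<^sub>3 =
    (let m = mass_symbol p; s = stiffness_symbol p; \<gamma> = gamma_coeff \<nu>
     in \<gamma> 1 * s \<theta>\<^sub>1 * m \<theta>\<^sub>2 * m \<theta>\<^sub>3 + \<gamma> 2 * m \<theta>\<^sub>1 * s \<theta>\<^sub>2 * m \<theta>\<^sub>3
        + \<gamma> 3 * m \<theta>\<^sub>1 * m \<theta>\<^sub>2 * s \<theta>\<^sub>3)"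

end

theory Submission
  imports Defs "HOL-Analysis.Henstock_Kurzweil_Integration"
begin

text \<open>
  Put \<open>w = exp (-i \<theta>)\<close>, which may be assumed different from 1 since otherwise \<open>a = s = 0\<close>,
  and let \<open>F\<^sub>q(t) = \<Sum>\<^sub>k \<phi>\<^sub>q(t + k) w\<^sup>k\<close> on \<open>[0, 1]\<close>. Then
  \<open>F\<^sub>q' = (1 - w) F\<^sub>q\<^sub>-\<^sub>1\<close> and \<open>F\<^sub>q(1) = w\<^sup>-\<^sup>1 F\<^sub>q(0)\<close>, so that repeated integration by parts
  (without boundary terms, since \<open>\<bar>w\<bar> = 1\<close>) evaluates the inner product of \<open>F\<^sub>r\<close> and \<open>F\<^sub>q\<close>
  as a multiple of \<open>F\<^sub>r\<^sub>+\<^sub>q\<^sub>+\<^sub>1(0)\<close>. Hence the mass and stiffness symbols are the squared norms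
  of \<open>F\<^sub>p\<close> and \<open>F\<^sub>p'\<close>, the advection symbol is the inner product of \<open>F\<^sub>p\<close> and \<open>i F\<^sub>p'\<close>, and
  Cauchy--Schwarz yields \<open>a\<^sup>2 \<le> m s\<close>. The symbol matrix equals
  \<open>\<alpha> L I + (\<beta> - \<alpha>) M\<close> with \<open>tr M = L\<close>. By \<open>a\<^sup>2 \<le> m s\<close> the matrix \<open>M\<close> is positive
  semidefinite, so its spectrum lies in \<open>[0, L]\<close>.
\<close>

section \<open>Support, positivity and symmetry of cardinal B-splines\<close>

lemma cardinal_bspline_support:
  "t < 0 \<or> real q + 1 \<le> t \<Longrightarrow> cardinal_bspline q t = 0"
  by (induction q arbitrary: t) auto

text \<open>In the recursion, a weight can be negative only where the spline it multiplies
  vanishes.\<close>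

lemma cardinal_bspline_nonneg: "0 \<le> cardinal_bspline q t"
proof (induction q arbitrary: t)
  case (Suc q)
  have "0 \<le> t * cardinal_bspline q t"
    using Suc[of t] cardinal_bspline_support[of t q] by (cases "t < 0") auto
  moreover have "0 \<le> (real (Suc q) + 1 - t) * cardinal_bspline q (t - 1)"
    using Suc[of "t - 1"] cardinal_bspline_support[of "t - 1" q]
    by (cases "real q + 1 \<le> t - 1") auto
  ultimately show ?case
    by (simp add: divide_simps)
qed simp

lemma cardinal_bspline_1:
  "cardinal_bspline (Suc 0) t = max 0 t - 2 * max 0 (t - 1) + max 0 (t - 2)"
  by auto

text \<open>Truncated squares are continuously differentiable, so this form yields the derivative at
  the knots too; it starts the induction in
  \<open>has_real_derivative_cardinal_bspline_Suc\<close>.\<close>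

lemma cardinal_bspline_2:
  "cardinal_bspline (Suc (Suc 0)) t =
     ((max 0 t)\<^sup>2 - 3 * (max 0 (t - 1))\<^sup>2 + 3 * (max 0 (t - 2))\<^sup>2 - (max 0 (t - 3))\<^sup>2) / 2"
proof -
  consider "t < 0" | "0 \<le> t" "t < 1" | "1 \<le> t" "t < 2" | "2 \<le> t" "t < 3" | "3 \<le> t"
    by linarith
  then show ?thesis
    by cases (simp_all add: max_def power2_eq_square field_simps)
qed

text \<open>Reflection swaps the two summands of the recursion. Degree 0 is excluded because the
  indicator of a half-open interval is not symmetric at its endpoints.\<close>

lemma cardinal_bspline_symmetric:
  "q \<ge> 1 \<Longrightarrow> cardinal_bspline q (real q + 1 - t) = cardinal_bspline q t"
proof (induction q arbitrary: t rule: dec_induct)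
  case base
  then show ?case by (auto simp: max_def)
next
  case (step q)
  have "cardinal_bspline q (real (Suc q) + 1 - t) = cardinal_bspline q (t - 1)"
    using step.IH[of "t - 1"] by (simp add: algebra_simps)
  moreover have "cardinal_bspline q (real (Suc q) + 1 - t - 1) = cardinal_bspline q t"
    using step.IH[of t] by (simp add: algebra_simps)
  ultimately show ?case
    by (simp only: cardinal_bspline.simps) (simp add: algebra_simps)
qed

lemma cardinal_bspline_0: "q \<ge> 1 \<Longrightarrow> cardinal_bspline q 0 = 0"
  using cardinal_bspline_symmetric[of q 0] cardinal_bspline_support[of "real q + 1" q] by simp

section \<open>Derivatives of cardinal B-splines\<close>

text \<open>The delicate point is \<open>x = c\<close>: the difference quotient of the truncated
  square is there the truncated identity, which tends to 0.\<close>

lemma has_real_derivative_max_square: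
  "((\<lambda>x::real. (max 0 (x - c))\<^sup>2) has_real_derivative 2 * max 0 (x - c)) (at x)"
proof -
  consider "x < c" | "x = c" | "x > c" by linarith
  then show ?thesis
  proof cases
    case 1
    have "((\<lambda>x. 0) has_real_derivative 0) (at x)" by simp
    from has_field_derivative_transform_within_open[OF this, of "{..<c}"] show ?thesis using 1
      by simp
  next
    case 2
    have "((\<lambda>h::real. max 0 h) \<longlongrightarrow> max 0 0) (at 0)"
      by (intro tendsto_intros)
    moreover have "(max 0 h)\<^sup>2 / h = max 0 h" for h :: real
      by (simp add: max_def power2_eq_square)
    ultimately show ?thesis using 2
      by (simp add: DERIV_def)
  next
    case 3
    have "((\<lambda>x. (x - c)\<^sup>2) has_real_derivative 2 * (x - c)) (at x)"
      by (auto intro!: derivative_eq_intros)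
    from has_field_derivative_transform_within_open[OF this, of "{c<..}"] show ?thesis using 3
      by simp
  qed
qed

text \<open>The hat function has kinks at 0, 1 and 2. Excluding all integers costs nothing later,
  since fibers are differentiated only inside the unit interval.\<close>

lemma has_real_derivative_cardinal_bspline_1:
  assumes "t \<notin> \<int>"
  shows "(cardinal_bspline (Suc 0) has_real_derivative
     cardinal_bspline 0 t - cardinal_bspline 0 (t - 1)) (at t)"
proof -
  have ne: "t \<noteq> 0" "t \<noteq> 1" "t \<noteq> 2"
    using assms by auto
  consider "t < 0" | "0 < t" "t < 1" | "1 < t" "t < 2" | "2 < t"
    using ne by linarith
  then show ?thesis
  proof cases
    case 1
    have "((\<lambda>x. 0) has_real_derivative 0) (at t)" by simp
    from has_field_derivative_transform_within_open[OF this, of "{..<0}"] show ?thesis using 1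
      by simp
  next
    case 2
    have "((\<lambda>x. x) has_real_derivative 1) (at t)" by simp
    from has_field_derivative_transform_within_open[OF this, of "{0<..<1}"] show ?thesis using 2
      by simp
  next
    case 3
    have "((\<lambda>x. 2 - x) has_real_derivative -1) (at t)" by (auto intro!: derivative_eq_intros)
    from has_field_derivative_transform_within_open[OF this, of "{1<..<2}"] show ?thesis using 3
      by simp
  next
    case 4
    have "((\<lambda>x. 0) has_real_derivative 0) (at t)" by simp
    from has_field_derivative_transform_within_open[OF this, of "{2<..}"] show ?thesis using 4
      by simp
  qed
qed

lemma has_real_derivative_cardinal_bspline_Suc:
  "q \<ge> 1 \<Longrightarrow> (cardinal_bspline (Suc q) has_real_derivative
     cardinal_bspline q t - cardinal_bspline q (t - 1)) (at t)"
proof (induction q arbitrary: t rule: dec_induct)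
  case base
  define g where "g c x = (max 0 (x - c))\<^sup>2" for c x :: real
  have g: "(g c has_real_derivative 2 * max 0 (x - c)) (at x)" for c x
    unfolding g_def by (rule has_real_derivative_max_square)
  have "cardinal_bspline (Suc 1) = (\<lambda>x. (g 0 x - 3 * g 1 x + 3 * g 2 x - g 3 x) / 2)"
    by (rule ext) (simp only: One_nat_def cardinal_bspline_2 g_def diff_zero)
  moreover have "((\<lambda>x. (g 0 x - 3 * g 1 x + 3 * g 2 x - g 3 x) / 2) has_real_derivative
      max 0 t - 3 * max 0 (t - 1) + 3 * max 0 (t - 2) - max 0 (t - 3)) (at t)"
    by (auto intro!: derivative_eq_intros g)
  moreover have "cardinal_bspline 1 t - cardinal_bspline 1 (t - 1) =
      max 0 t - 3 * max 0 (t - 1) + 3 * max 0 (t - 2) - max 0 (t - 3)"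
    by (simp only: One_nat_def cardinal_bspline_1) (simp add: algebra_simps)
  ultimately show ?case by (simp only:)
next
  case (step q)
  let ?b = "cardinal_bspline q" and ?c = "cardinal_bspline (Suc q)"
  have c: "?c t = t / real (Suc q) * ?b t
     + (real (Suc q) + 1 - t) / real (Suc q) * ?b (t - 1)" for t
    by simp
  have D: "(?c has_real_derivative ?b t - ?b (t - 1)) (at t)" for t
    by (rule step.IH)
  have D': "((\<lambda>t. ?c (t - 1)) has_real_derivative ?b (t - 1) - ?b (t - 2)) (at t)"
    using D[of "t - 1"] DERIV_shift[of ?c _ t "-1"] by simp
  have "cardinal_bspline (Suc (Suc q)) = (\<lambda>t. t / real (Suc (Suc q)) * ?c t
     + (real (Suc (Suc q)) + 1 - t) / real (Suc (Suc q)) * ?c (t - 1))"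
    by (simp only: cardinal_bspline.simps)
  moreover have "((\<lambda>t. t / real (Suc (Suc q)) * ?c t
     + (real (Suc (Suc q)) + 1 - t) / real (Suc (Suc q)) * ?c (t - 1)) has_real_derivative
     ((?c t + t * (?b t - ?b (t - 1))) / real (Suc (Suc q))
     + ((real (Suc (Suc q)) + 1 - t) * (?b (t - 1) - ?b (t - 2)) - ?c (t - 1)) / real (Suc (Suc q)))) (at t)"
    by (rule derivative_eq_intros D D' refl | simp del: cardinal_bspline.simps of_nat_Suc)+
       (simp del: cardinal_bspline.simps of_nat_Suc add: field_simps)
  \<comment> \<open>By the recursion for \<open>?c\<close> at \<open>t\<close> and
    \<open>t - 1\<close>, the \<open>?b\<close> terms add up to
    \<open>real (Suc q) * (?c t - ?c (t - 1))\<close>; the two free \<open>?c\<close> terms supply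
    the missing multiple.\<close>
  moreover have "(?c t + t * (?b t - ?b (t - 1))) / real (Suc (Suc q))
     + ((real (Suc (Suc q)) + 1 - t) * (?b (t - 1) - ?b (t - 2)) - ?c (t - 1)) / real (Suc (Suc q))
     = ?c t - ?c (t - 1)"
    by (simp add: divide_simps) (simp add: algebra_simps)
  ultimately show ?case by (simp only:)
qed

section \<open>Spline fibers: weighted sums over integer translates\<close>

declare cardinal_bspline.simps(2) [simp del]

text \<open>On \<open>[0, 1)\<close> this is \<open>\<Sum>\<^sub>k \<phi>\<^sub>q(t + k) w\<^sup>k\<close>; the constant 1 for
  \<open>q = 0\<close> repairs the jump of \<open>\<phi>\<^sub>0\<close> and makes the function continuous on \<open>[0, 1]\<close>
  for every \<open>q\<close>.\<close>

definition spline_fiber :: "nat \<Rightarrow> complex \<Rightarrow> real \<Rightarrow> complex" where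
  "spline_fiber q w t =
     (if q = 0 then 1 else \<Sum>k\<le>q. of_real (cardinal_bspline q (t + real k)) * w ^ k)"

lemma spline_fiber_eq_sum:
  assumes "0 \<le> t" "t < 1"
  shows "spline_fiber q w t = (\<Sum>k\<le>q. of_real (cardinal_bspline q (t + real k)) * w ^ k)"
  using assms by (simp add: spline_fiber_def)

text \<open>An index shift in the second half of the difference produces the factor
  \<open>w\<close>; the assumptions remove the two terms left over at the ends. This serves both the
  derivative of a fiber and the difference formulas for the symbols.\<close>

lemma sum_backward_difference:
  fixes w :: complex and g :: "real \<Rightarrow> real"
  assumes "g (t - 1) = 0" "g (t + real (Suc n)) = 0"
  shows "(\<Sum>k\<le>Suc n. of_real (g (t + real k) - g (t + real k - 1)) * w ^ k)
    = (1 - w) * (\<Sum>k\<le>n. of_real (g (t + real k)) * w ^ k)"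
proof -
  have "(\<Sum>k\<le>Suc n. of_real (g (t + real k)) * w ^ k) = (\<Sum>k\<le>n. of_real (g (t + real k)) * w ^ k)"
    using assms by simp
  moreover have "(\<Sum>k\<le>Suc n. of_real (g (t + real k - 1)) * w ^ k)
      = w * (\<Sum>k\<le>n. of_real (g (t + real k)) * w ^ k)"
    using assms by (subst sum.atMost_Suc_shift) (simp add: sum_distrib_left algebra_simps)
  ultimately show ?thesis
    by (simp add: left_diff_distrib sum_subtractf del: sum.atMost_Suc)
qed

lemma has_real_derivative_cardinal_bspline:
  assumes "q \<ge> 1 \<or> t \<notin> \<int>"
  shows "(cardinal_bspline (Suc q) has_real_derivative
     cardinal_bspline q t - cardinal_bspline q (t - 1)) (at t)"
proof (cases "q \<ge> 1")
  case True
  then show ?thesis by (rule has_real_derivative_cardinal_bspline_Suc)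
next
  case False
  then have "q = 0" by simp
  then show ?thesis
    using has_real_derivative_cardinal_bspline_1 assms False by blast
qed

lemma continuous_on_cardinal_bspline:
  assumes "q \<ge> 1"
  shows "continuous_on S (cardinal_bspline q)"
proof (cases "q = 1")
  case True
  have "cardinal_bspline 1 = (\<lambda>t. max 0 t - 2 * max 0 (t - 1) + max 0 (t - 2))"
    by (rule ext) (simp only: One_nat_def cardinal_bspline_1)
  moreover have "continuous_on S (\<lambda>t::real. max 0 t - 2 * max 0 (t - 1) + max 0 (t - 2))"
    by (intro continuous_intros)
  ultimately show ?thesis using True by (simp only:)
next
  case False
  with assms obtain r where "q = Suc r" "r \<ge> 1"
    by (cases q) auto
  then show ?thesis
    using has_real_derivative_cardinal_bspline[of r] 
    by (intro DERIV_continuous_on[of S _ "\<lambda>t. cardinal_bspline r t - cardinal_bspline r (t - 1)"])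
       (auto intro: has_field_derivative_at_within)
qed

lemma continuous_on_spline_fiber: "continuous_on S (spline_fiber q w)"
proof (cases "q = 0")
  case True
  then have eq: "spline_fiber q w = (\<lambda>_. 1)"
    by (simp add: spline_fiber_def fun_eq_iff)
  show ?thesis
    unfolding eq by (rule continuous_on_const)
next
  case False
  have "continuous_on S (\<lambda>t. cardinal_bspline q (t + real k))" for k
    using continuous_on_cardinal_bspline[of q UNIV] False
    by (rule_tac continuous_on_compose2[of UNIV "cardinal_bspline q"]) (auto intro!: continuous_intros)
  then have "continuous_on S (\<lambda>t. \<Sum>k\<le>q. of_real (cardinal_bspline q (t + real k)) * w ^ k)"
    by (intro continuous_intros)
  also have "(\<lambda>t. \<Sum>k\<le>q. of_real (cardinal_bspline q (t + real k)) * w ^ k) = spline_fiber q w"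
    using False by (intro ext) (simp only: spline_fiber_def if_False)
  finally show ?thesis .
qed

text \<open>Differentiation turns each spline into a backward difference, and
  \<open>sum_backward_difference\<close> pulls out \<open>1 - w\<close>.\<close>

lemma has_vector_derivative_spline_fiber:
  assumes "t \<in> {0<..<1}"
  shows "(spline_fiber (Suc q) w has_vector_derivative (1 - w) * spline_fiber q w t) (at t)"
proof -
  \<comment> \<open>Staying off the integers covers \<open>q = 0\<close>, where the splines being
    differentiated have kinks.\<close>
  have "t + real k \<notin> \<int>" for k
  proof
    assume "t + real k \<in> \<int>"
    then have "t + real k - real k \<in> \<int>" by (intro Ints_diff) auto
    then have "t \<in> \<int>" by simp
    then obtain n where "t = real_of_int n" by (auto elim: Ints_cases)
    with assms show False by auto
  qed
  then have D: "((\<lambda>t. cardinal_bspline (Suc q) (t + real k)) has_real_derivative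
      cardinal_bspline q (t + real k) - cardinal_bspline q (t + real k - 1)) (at t)" for k
    using has_real_derivative_cardinal_bspline[of q "t + real k"]
      DERIV_shift[of "cardinal_bspline (Suc q)" _ t "real k"] by blast
  have "((\<lambda>t. \<Sum>k\<le>Suc q. of_real (cardinal_bspline (Suc q) (t + real k)) * w ^ k) has_vector_derivative
      (\<Sum>k\<le>Suc q. of_real (cardinal_bspline q (t + real k) - cardinal_bspline q (t + real k - 1)) * w ^ k)) (at t)"
    by (intro has_vector_derivative_sum has_vector_derivative_mult_left has_vector_derivative_of_real D)
  also have "(\<lambda>t. \<Sum>k\<le>Suc q. of_real (cardinal_bspline (Suc q) (t + real k)) * w ^ k) = spline_fiber (Suc q) w"
    by (rule ext) (simp only: spline_fiber_def nat.distinct if_False)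
  also have "(\<Sum>k\<le>Suc q. of_real (cardinal_bspline q (t + real k) - cardinal_bspline q (t + real k - 1)) * w ^ k)
      = (1 - w) * spline_fiber q w t"
    using assms cardinal_bspline_support[of "t - 1" q] cardinal_bspline_support[of "t + real (Suc q)" q]
    by (subst sum_backward_difference) (simp_all add: spline_fiber_eq_sum)
  finally show ?thesis .
qed

text \<open>Moving from 0 to 1 shifts the summation index by one; the extra end terms vanish because
  the spline is 0 at both ends of its support.\<close>

lemma spline_fiber_1:
  assumes "q \<ge> 1"
  shows "w * spline_fiber q w 1 = spline_fiber q w 0"
proof -
  have z: "cardinal_bspline q 0 = 0" "cardinal_bspline q (real q + 1) = 0"
    using assms cardinal_bspline_0 cardinal_bspline_support[of "real q + 1" q] by auto
  have "w * spline_fiber q w 1 = (\<Sum>k\<le>q. of_real (cardinal_bspline q (real (Suc k))) * w ^ Suc k)"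
    using assms by (simp add: spline_fiber_def sum_distrib_left algebra_simps)
  also have "\<dots> = (\<Sum>k\<le>Suc q. of_real (cardinal_bspline q (real k)) * w ^ k)"
    by (subst sum.atMost_Suc_shift) (simp add: z)
  also have "\<dots> = spline_fiber q w 0"
    using z assms by (simp add: spline_fiber_def add.commute)
  finally show ?thesis .
qed

lemma spline_fiber_Suc_1:
  assumes "norm w = 1"
  shows "spline_fiber (Suc q) w 1 = cnj w * spline_fiber (Suc q) w 0"
proof -
  have "cnj w * w = 1"
    using assms complex_norm_square[of w] by (simp add: mult.commute)
  moreover have "cnj w * (w * spline_fiber (Suc q) w 1) = cnj w * spline_fiber (Suc q) w 0"
    by (subst spline_fiber_1) simp_all
  ultimately show ?thesis
    by (simp add: mult.assoc[symmetric])
qed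

section \<open>Inner products of fibers\<close>

text \<open>Each integration by parts lowers the degree of the conjugated factor and raises that of
  the other, so \<open>r\<close> has to stay arbitrary in the induction. The condition
  \<open>w \<noteq> 1\<close> allows division by \<open>1 - w\<close>.\<close>

lemma has_integral_spline_fiber_mult_cnj:
  assumes w: "norm w = 1" "w \<noteq> 1"
  shows "((\<lambda>t. spline_fiber r w t * cnj (spline_fiber q w t)) has_integral
           cnj w ^ Suc q * spline_fiber (Suc (r + q)) w 0) {0..1}"
proof -
  have ww: "cnj w * w = 1"
    using w complex_norm_square[of w] by (simp add: mult.commute)
  have w': "inverse (1 - w) * ((1 - w) * x) = x" for x
    using w by simp
  show ?thesis
  proof (induction q arbitrary: r)
    case 0
    have "((\<lambda>t. (1 - w) * spline_fiber r w t) has_integral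
        (spline_fiber (Suc r) w 1 - spline_fiber (Suc r) w 0)) {0..1}"
      by (intro fundamental_theorem_of_calculus_interior[where f = "spline_fiber (Suc r) w"]
          has_vector_derivative_spline_fiber
          continuous_on_spline_fiber) auto
    also have "spline_fiber (Suc r) w 1 - spline_fiber (Suc r) w 0
        = (1 - w) * (cnj w * spline_fiber (Suc r) w 0)"
    proof -
      have "(1 - w) * (cnj w * x) = cnj w * x - (cnj w * w) * x" for x
        by (simp add: algebra_simps)
      then show ?thesis
        using w ww by (simp add: spline_fiber_Suc_1)
    qed
    finally have "((\<lambda>t. inverse (1 - w) * ((1 - w) * spline_fiber r w t)) has_integral
        inverse (1 - w) * ((1 - w) * (cnj w * spline_fiber (Suc r) w 0))) {0..1}"
      by (rule has_integral_mult_right)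
    then show ?case
      unfolding w' by (simp add: spline_fiber_def[of 0])
  next
    case (Suc q)
    let ?B = "\<lambda>q. spline_fiber q w"
    \<comment> \<open>The integrand is the derivative of
      \<open>?B (Suc r) t * cnj (?B (Suc q) t)\<close>. The endpoint values agree, as the factors
      \<open>cnj w\<close> and \<open>w\<close> picked up at 1 cancel.\<close>
    have "((\<lambda>t. ?B (Suc r) t * cnj ((1 - w) * ?B q t) + (1 - w) * ?B r t * cnj (?B (Suc q) t)) has_integral
        (?B (Suc r) 1 * cnj (?B (Suc q) 1) - ?B (Suc r) 0 * cnj (?B (Suc q) 0))) {0..1}"
      by (intro fundamental_theorem_of_calculus_interior[where f = "\<lambda>t. ?B (Suc r) t * cnj (?B (Suc q) t)"]
          has_vector_derivative_mult has_vector_derivative_cnj has_vector_derivative_spline_fiber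
          continuous_on_spline_fiber continuous_intros) auto
    also have "?B (Suc r) 1 * cnj (?B (Suc q) 1) = (cnj w * w) * (?B (Suc r) 0 * cnj (?B (Suc q) 0))"
      using w by (simp add: spline_fiber_Suc_1)
    finally have *: "((\<lambda>t. ?B (Suc r) t * cnj ((1 - w) * ?B q t)
        + (1 - w) * ?B r t * cnj (?B (Suc q) t)) has_integral 0) {0..1}"
      using ww by simp
    \<comment> \<open>Source of the additional factor \<open>cnj w\<close> in each induction
      step.\<close>
    have "- cnj (1 - w) = (1 - w) * cnj w"
      using ww by (simp add: algebra_simps)
    then have c: "- (cnj (1 - w) * x) = (1 - w) * (cnj w * x)" for x
      by (simp only: mult.assoc[symmetric] minus_mult_left)
    have "?B (Suc r) t * cnj ((1 - w) * ?B q t) + (1 - w) * ?B r t * cnj (?B (Suc q) t)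
        - cnj (1 - w) * (?B (Suc r) t * cnj (?B q t)) = (1 - w) * (?B r t * cnj (?B (Suc q) t))" for t
      by (simp add: mult.assoc mult.left_commute)
    with has_integral_diff[OF * has_integral_mult_right[OF Suc.IH[of "Suc r"], of "cnj (1 - w)"]]
    have "((\<lambda>t. (1 - w) * (?B r t * cnj (?B (Suc q) t))) has_integral
        - (cnj (1 - w) * (cnj w ^ Suc q * ?B (Suc (Suc r + q)) 0))) {0..1}"
      by (simp only: diff_0)
    from has_integral_mult_right[OF this, of "inverse (1 - w)"]
    show ?case
      unfolding c w' by (simp add: mult.assoc)
  qed
qed

section \<open>The univariate symbols as fiber values at 0\<close>

lemma deriv_cardinal_bspline:
  assumes "q \<ge> 1"
  shows "deriv (cardinal_bspline (Suc q)) = (\<lambda>t. cardinal_bspline q t - cardinal_bspline q (t - 1))"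
  using has_real_derivative_cardinal_bspline_Suc[OF assms] by (intro ext DERIV_imp_deriv)

lemma deriv_deriv_cardinal_bspline:
  assumes "q \<ge> 1"
  shows "deriv (deriv (cardinal_bspline (Suc (Suc q)))) =
    (\<lambda>t. (cardinal_bspline q t - cardinal_bspline q (t - 1))
        - (cardinal_bspline q (t - 1) - cardinal_bspline q (t - 1 - 1)))"
proof -
  have D: "(cardinal_bspline (Suc q) has_real_derivative
     cardinal_bspline q t - cardinal_bspline q (t - 1)) (at t)" for t
    using has_real_derivative_cardinal_bspline_Suc[OF assms] .
  moreover have "((\<lambda>t. cardinal_bspline (Suc q) (t - 1)) has_real_derivative
     cardinal_bspline q (t - 1) - cardinal_bspline q (t - 1 - 1)) (at t)" for t
    using D[of "t - 1"] DERIV_shift[of "cardinal_bspline (Suc q)" _ t "-1"] by simp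
  ultimately show ?thesis
    unfolding deriv_cardinal_bspline[of "Suc q", OF le_SucI[OF assms]]
    by (intro ext DERIV_imp_deriv DERIV_diff)
qed

text \<open>Pairs the indices that are mirror images about \<open>p + 1\<close>, the centre of the
  support of the spline of degree \<open>2*p+1\<close>; index 0 has no partner in the range.\<close>

lemma sum_atMost_odd_split:
  fixes h :: "nat \<Rightarrow> 'a::comm_monoid_add"
  shows "(\<Sum>j\<le>2*p+1. h j) = h 0 + h (p + 1) + (\<Sum>k=1..p. h (p + 1 - k) + h (p + 1 + k))"
proof -
  have "{..2*p+1} = insert 0 (insert (p + 1) ({1..p} \<union> {p+2..2*p+1}))" by auto
  then have "(\<Sum>j\<le>2*p+1. h j) = h 0 + (h (p + 1) + ((\<Sum>j=1..p. h j) + (\<Sum>j=p+2..2*p+1. h j)))"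
    by (simp only:) (subst sum.insert | subst sum.union_disjoint | force)+
  moreover have "(\<Sum>j=1..p. h j) = (\<Sum>k=1..p. h (p + 1 - k))"
    by (rule sum.reindex_bij_witness[of _ "\<lambda>k. p + 1 - k" "\<lambda>k. p + 1 - k"]) auto
  moreover have "(\<Sum>j=p+2..2*p+1. h j) = (\<Sum>k=1..p. h (p + 1 + k))"
    by (rule sum.reindex_bij_witness[of _ "\<lambda>k. p + 1 + k" "\<lambda>k. k - (p + 1)"]) auto
  ultimately show ?thesis
    by (simp add: sum.distrib add.assoc)
qed

text \<open>The power of \<open>cis \<theta>\<close> recentres the exponents at
  \<open>p + 1\<close>, so mirrored coefficients meet conjugate exponentials: even \<open>g\<close>
  gives cosines, odd \<open>g\<close> gives sines.\<close>

lemma cis_mult_sum: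
  fixes g :: "real \<Rightarrow> real"
  assumes "g 0 = 0"
  shows "cis \<theta> ^ (p + 1) * (\<Sum>k\<le>2*p+1. of_real (g (real k)) * cis (-\<theta>) ^ k) =
    of_real (g (real p + 1)) + (\<Sum>k=1..p. of_real (g (real p + 1 - real k)) * cis (real k * \<theta>)
        + of_real (g (real p + 1 + real k)) * cis (- (real k * \<theta>)))"
proof -
  define h where "h k = of_real (g (real k)) * cis ((real p + 1 - real k) * \<theta>)" for k
  have "cis \<theta> ^ (p + 1) * (\<Sum>k\<le>2*p+1. of_real (g (real k)) * cis (-\<theta>) ^ k) = (\<Sum>k\<le>2*p+1. h k)"
    unfolding sum_distrib_left
    by (intro sum.cong refl) (simp only: h_def Complex.DeMoivre mult.left_commute[of "cis _"] cis_mult,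
        simp add: algebra_simps)
  also have "\<dots> = h 0 + h (p + 1) + (\<Sum>k=1..p. h (p + 1 - k) + h (p + 1 + k))"
    by (rule sum_atMost_odd_split)
  also have "(\<Sum>k=1..p. h (p + 1 - k) + h (p + 1 + k)) =
      (\<Sum>k=1..p. of_real (g (real p + 1 - real k)) * cis (real k * \<theta>)
        + of_real (g (real p + 1 + real k)) * cis (- (real k * \<theta>)))"
    by (intro sum.cong refl) (simp add: h_def of_nat_diff algebra_simps)
  finally show ?thesis
    by (simp add: h_def assms add.commute[of 1] del: sum.atMost_Suc)
qed

lemma cis_mult_sum_even:
  fixes g :: "real \<Rightarrow> real"
  assumes "g 0 = 0" "\<And>t. g (2 * real p + 2 - t) = g t"
  shows "cis \<theta> ^ (p + 1) * (\<Sum>k\<le>2*p+1. of_real (g (real k)) * cis (-\<theta>) ^ k) =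
    of_real (g (real p + 1) + 2 * (\<Sum>k=1..p. g (real p + 1 - real k) * cos (real k * \<theta>)))"
proof -
  have "g (real p + 1 + real k) = g (real p + 1 - real k)" for k
    using assms(2)[of "real p + 1 - real k"] by (simp add: algebra_simps)
  then have "(\<Sum>k=1..p. of_real (g (real p + 1 - real k)) * cis (real k * \<theta>)
        + of_real (g (real p + 1 + real k)) * cis (- (real k * \<theta>)))
      = of_real (2 * (\<Sum>k=1..p. g (real p + 1 - real k) * cos (real k * \<theta>)))"
    unfolding sum_distrib_left of_real_sum
    by (intro sum.cong refl) (simp add: complex_eq_iff)
  then show ?thesis
    unfolding cis_mult_sum[of g, OF assms(1)] by simp
qed

lemma cis_mult_sum_odd:
  fixes g :: "real \<Rightarrow> real"
  assumes "g 0 = 0" "\<And>t. g (2 * real p + 2 - t) = - g t"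
  shows "cis \<theta> ^ (p + 1) * (\<Sum>k\<le>2*p+1. of_real (g (real k)) * cis (-\<theta>) ^ k) =
    \<i> * of_real (2 * (\<Sum>k=1..p. g (real p + 1 - real k) * sin (real k * \<theta>)))"
proof -
  have "g (real p + 1 + real k) = - g (real p + 1 - real k)" for k
    using assms(2)[of "real p + 1 - real k"] by (simp add: algebra_simps)
  then have "(\<Sum>k=1..p. of_real (g (real p + 1 - real k)) * cis (real k * \<theta>)
        + of_real (g (real p + 1 + real k)) * cis (- (real k * \<theta>)))
      = \<i> * of_real (2 * (\<Sum>k=1..p. g (real p + 1 - real k) * sin (real k * \<theta>)))"
    unfolding sum_distrib_left of_real_sum
    by (intro sum.cong refl) (simp add: complex_eq_iff)
  moreover have "g (real p + 1) = 0"
    using assms(2)[of "real p + 1"] by simp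
  ultimately show ?thesis
    unfolding cis_mult_sum[of g, OF assms(1)] by simp
qed

lemma spline_fiber_0: "spline_fiber q w 0 = (\<Sum>k\<le>q. of_real (cardinal_bspline q (real k)) * w ^ k)"
  using spline_fiber_eq_sum[of 0 q w] by simp

lemma mass_symbol_eq_spline_fiber:
  "of_real (mass_symbol p \<theta>) = cis \<theta> ^ (p + 1) * spline_fiber (2*p+1) (cis (-\<theta>)) 0"
  using cis_mult_sum_even[of "cardinal_bspline (2*p+1)" p \<theta>] cardinal_bspline_0[of "2*p+1"]
    cardinal_bspline_symmetric[of "2*p+1"]
  by (simp add: mass_symbol_def spline_fiber_0 add.commute del: sum.atMost_Suc)

text \<open>The first derivative is the backward difference of the spline of degree
  \<open>2*p\<close>: odd about \<open>p + 1\<close>, hence a sine sum, and a difference, hence the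
  factor \<open>1 - w\<close> with \<open>w = cis (-\<theta>)\<close>.\<close>

lemma advection_symbol_eq_spline_fiber:
  assumes "p \<ge> 1"
  shows "- \<i> * of_real (advection_symbol p \<theta>) =
    cis \<theta> ^ (p + 1) * ((1 - cis (-\<theta>)) * spline_fiber (2*p) (cis (-\<theta>)) 0)"
proof -
  let ?b = "cardinal_bspline (2*p)"
  define g where "g = deriv (cardinal_bspline (2*p+1))"
  have g: "g = (\<lambda>t. ?b t - ?b (t - 1))"
    using deriv_cardinal_bspline[of "2*p"] assms by (simp add: g_def)
  have z: "?b 0 = 0" "?b (- 1) = 0" "?b (real (Suc (2*p))) = 0"
    using assms cardinal_bspline_0[of "2*p"] cardinal_bspline_support[of _ "2*p"] by auto
  have sym: "?b (2 * real p + 1 - t) = ?b t" for t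
    using cardinal_bspline_symmetric[of "2*p" t] assms by simp
  have "g (2 * real p + 2 - t) = - g t" for t
    using sym[of t] sym[of "t - 1"] by (simp add: g algebra_simps)
  moreover have "g 0 = 0" by (simp add: g z)
  ultimately have "cis \<theta> ^ (p + 1) * (\<Sum>k\<le>2*p+1. of_real (g (real k)) * cis (-\<theta>) ^ k) =
      - \<i> * of_real (advection_symbol p \<theta>)"
    by (subst cis_mult_sum_odd) (simp_all add: advection_symbol_def g_def)
  moreover have "(\<Sum>k\<le>2*p+1. of_real (g (real k)) * cis (-\<theta>) ^ k)
      = (1 - cis (-\<theta>)) * spline_fiber (2*p) (cis (-\<theta>)) 0"
    using sum_backward_difference[of ?b 0 "2*p" "cis (-\<theta>)"] z
    by (simp add: g spline_fiber_0 del: sum.atMost_Suc)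
  ultimately show ?thesis by simp
qed

text \<open>The second derivative is a twofold backward difference, even about \<open>p + 1\<close>;
  two applications of \<open>sum_backward_difference\<close> give the squared factor.\<close>

lemma stiffness_symbol_eq_spline_fiber:
  assumes "p \<ge> 1"
  shows "- of_real (stiffness_symbol p \<theta>) =
    cis \<theta> ^ (p + 1) * ((1 - cis (-\<theta>))\<^sup>2 * spline_fiber (2*p-1) (cis (-\<theta>)) 0)"
proof -
  obtain q where q: "2 * p = Suc q" "q \<ge> 1" "2 * p - 1 = q"
    using assms by (intro that[of "2*p-1"]) auto
  then have rq: "2 * real p = real q + 1" by linarith
  let ?b = "cardinal_bspline q"
  define d where "d t = ?b t - ?b (t - 1)" for t
  define g where "g = deriv (deriv (cardinal_bspline (2*p+1)))"
  have g: "g = (\<lambda>t. d t - d (t - 1))"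
    using deriv_deriv_cardinal_bspline[of q] q by (simp add: g_def d_def)
  have z: "?b t = 0" if "t \<le> 0 \<or> real q + 1 \<le> t" for t
    using that q cardinal_bspline_0[of q] cardinal_bspline_support[of t q] by (cases "t = 0") auto
  have sym: "?b (2 * real p - t) = ?b t" for t
    using cardinal_bspline_symmetric[of q t] q rq by simp
  have "g (2 * real p + 2 - t) = g t" for t
    using sym[of t] sym[of "t - 1"] sym[of "t - 1 - 1"] by (simp add: g d_def algebra_simps)
  moreover have "g 0 = 0" by (simp add: g d_def z)
  ultimately have "cis \<theta> ^ (p + 1) * (\<Sum>k\<le>2*p+1. of_real (g (real k)) * cis (-\<theta>) ^ k) =
      - of_real (stiffness_symbol p \<theta>)"
    by (subst cis_mult_sum_even) (simp_all add: stiffness_symbol_def g_def)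
  moreover have "(\<Sum>k\<le>2*p+1. of_real (g (real k)) * cis (-\<theta>) ^ k)
      = (1 - cis (-\<theta>)) * (\<Sum>k\<le>Suc q. of_real (d (real k)) * cis (-\<theta>) ^ k)"
    using sum_backward_difference[of d 0 "2*p" "cis (-\<theta>)"] rq q(1)
    by (simp add: g d_def z del: sum.atMost_Suc)
  moreover have "(\<Sum>k\<le>Suc q. of_real (d (real k)) * cis (-\<theta>) ^ k)
      = (1 - cis (-\<theta>)) * spline_fiber q (cis (-\<theta>)) 0"
    using sum_backward_difference[of ?b 0 q "cis (-\<theta>)"]
    by (simp add: z d_def spline_fiber_0 del: sum.atMost_Suc)
  ultimately show ?thesis by (simp add: q power2_eq_square mult.assoc)
qed

section \<open>Cauchy-Schwarz inequality between the univariate symbols\<close>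

text \<open>The arguments \<open>(s, -a)\<close> and \<open>(-a, m)\<close> give the discriminant
  multiplied by \<open>s\<close> and by \<open>m\<close>. If both vanish, \<open>(1, -a)\<close>
  gives \<open>- 2 * a\<^sup>2 \<ge> 0\<close>.\<close>

lemma nonneg_quadratic_formD:
  fixes m a s :: real
  assumes "\<And>b c. 0 \<le> b\<^sup>2 * m + 2 * b * c * a + c\<^sup>2 * s"
  shows "0 \<le> m" "0 \<le> s" "a\<^sup>2 \<le> m * s"
proof -
  show m: "0 \<le> m" using assms[of 1 0] by simp
  show s: "0 \<le> s" using assms[of 0 1] by simp
  have 1: "0 \<le> s * (m * s - a\<^sup>2)"
    using assms[of s "-a"] by (simp add: power2_eq_square algebra_simps)
  have 2: "0 \<le> m * (m * s - a\<^sup>2)"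
    using assms[of "-a" m] by (simp add: power2_eq_square algebra_simps)
  show "a\<^sup>2 \<le> m * s"
  proof (cases "m = 0 \<and> s = 0")
    case True
    then show ?thesis using assms[of 1 "-a"] by (simp add: power2_eq_square)
  next
    case False
    then consider "0 < m" | "0 < s" using m s by linarith
    then show ?thesis
      using 1 2 by cases (simp_all add: zero_le_mult_iff)
  qed
qed

lemma symbol_quadratic_form_nonneg:
  assumes p: "p \<ge> 1"
  shows "0 \<le> b\<^sup>2 * mass_symbol p \<theta> + 2 * b * c * advection_symbol p \<theta> + c\<^sup>2 * stiffness_symbol p \<theta>"
proof -
  define w where "w = cis (-\<theta>)"
  define F where "F q = spline_fiber q w" for q
  let ?m = "mass_symbol p \<theta>" and ?a = "advection_symbol p \<theta>" and ?s = "stiffness_symbol p \<theta>"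
  have cw: "cis \<theta> = cnj w" and nw: "norm w = 1"
    by (simp_all add: w_def cis_cnj)
  have ww: "cnj w * w = 1" by (simp add: w_def cis_cnj cis_mult)
  note sym = mass_symbol_eq_spline_fiber[of p \<theta>, folded w_def, folded F_def, unfolded cw]
    advection_symbol_eq_spline_fiber[OF p, of \<theta>, folded w_def, folded F_def, unfolded cw]
    stiffness_symbol_eq_spline_fiber[OF p, of \<theta>, folded w_def, folded F_def, unfolded cw]
  show ?thesis
  proof (cases "w = 1")
    case True
    have "of_real ?m = (of_real (\<Sum>k\<le>2*p+1. cardinal_bspline (2*p+1) (real k)) :: complex)"
      unfolding sym(1) by (simp add: True F_def spline_fiber_0 del: sum.atMost_Suc)
    then have "?m = (\<Sum>k\<le>2*p+1. cardinal_bspline (2*p+1) (real k))"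
      by (simp only: of_real_eq_iff)
    then have "0 \<le> ?m" by (simp only:) (intro sum_nonneg cardinal_bspline_nonneg)
    moreover have "?a = 0" "?s = 0" using sym(2,3) True by simp_all
    ultimately show ?thesis by simp
  next
    case False
    obtain r where r: "p = Suc r" using p by (cases p) auto
    \<comment> \<open>\<open>G\<close> is \<open>\<i>\<close> times the derivative of
      \<open>F p\<close>; the factor \<open>\<i>\<close> makes its inner product with
      \<open>F p\<close> real.\<close>
    define G where "G t = \<i> * (1 - w) * F r t" for t
    have FF: "((\<lambda>t. F p t * cnj (F p t)) has_integral of_real ?m) {0..1}"
      using has_integral_spline_fiber_mult_cnj[OF nw False, of p p]
      unfolding sym(1) by (simp add: F_def mult_2)
    have "((\<lambda>t. F p t * cnj (F r t)) has_integral cnj w ^ p * F (2*p) 0) {0..1}"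
      using has_integral_spline_fiber_mult_cnj[OF nw False, of p r]
      by (simp add: F_def r mult_2)
    from has_integral_mult_right[OF this, of "cnj (\<i> * (1 - w))"]
    have "((\<lambda>t. F p t * cnj (G t)) has_integral cnj (\<i> * (1 - w)) * (cnj w ^ p * F (2*p) 0)) {0..1}"
      by (simp add: G_def mult_ac)
    \<comment> \<open>One of the \<open>p + 1\<close> factors \<open>cnj w\<close> is spent on
      \<open>cnj w * (1 - w) = - cnj (1 - w)\<close>.\<close>
    moreover have "cnj (\<i> * (1 - w)) * (cnj w ^ p * F (2*p) 0) = of_real ?a"
    proof -
      have "of_real ?a = \<i> * (- \<i> * of_real ?a)" by simp
      also have "\<dots> = \<i> * ((cnj w - cnj w * w) * (cnj w ^ p * F (2*p) 0))"
        unfolding sym(2) by (simp add: algebra_simps)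
      finally show ?thesis unfolding ww by (simp add: algebra_simps)
    qed
    ultimately have FG: "((\<lambda>t. F p t * cnj (G t)) has_integral of_real ?a) {0..1}" by simp
    have "((\<lambda>t. F r t * cnj (F r t)) has_integral cnj w ^ p * F (2*p-1) 0) {0..1}"
      using has_integral_spline_fiber_mult_cnj[OF nw False, of r r]
      by (simp add: F_def r mult_2)
    from has_integral_mult_right[OF this, of "(1 - w) * cnj (1 - w)"]
    have "((\<lambda>t. G t * cnj (G t)) has_integral (1 - w) * cnj (1 - w) * (cnj w ^ p * F (2*p-1) 0)) {0..1}"
      by (simp add: G_def mult_ac)
    moreover have "(1 - w) * cnj (1 - w) * (cnj w ^ p * F (2*p-1) 0) = of_real ?s"
    proof -
      have "of_real ?s = - (- of_real ?s :: complex)" by simp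
      also have "\<dots> = - ((1 - w) * (cnj w - cnj w * w) * (cnj w ^ p * F (2*p-1) 0))"
        unfolding sym(3) by (simp add: power2_eq_square algebra_simps)
      finally show ?thesis unfolding ww by (simp add: algebra_simps)
    qed
    ultimately have GG: "((\<lambda>t. G t * cnj (G t)) has_integral of_real ?s) {0..1}" by simp
    note Re = has_integral_linear[OF _ bounded_linear_Re, unfolded o_def]
    from has_integral_add[OF has_integral_add[OF
        has_integral_mult_right[OF Re[OF FF], of "b\<^sup>2"]
        has_integral_mult_right[OF Re[OF FG], of "2 * b * c"]]
        has_integral_mult_right[OF Re[OF GG], of "c\<^sup>2"]]
    have I: "((\<lambda>t. b\<^sup>2 * Re (F p t * cnj (F p t)) + 2 * b * c * Re (F p t * cnj (G t))
        + c\<^sup>2 * Re (G t * cnj (G t))) has_integral b\<^sup>2 * ?m + 2 * b * c * ?a + c\<^sup>2 * ?s) {0..1}"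
      by simp
    \<comment> \<open>The integrand is the squared modulus of
      \<open>b * F p t + c * G t\<close>.\<close>
    have "b\<^sup>2 * Re (x * cnj x) + 2 * b * c * Re (x * cnj y) + c\<^sup>2 * Re (y * cnj y)
        = (b * Re x + c * Re y)\<^sup>2 + (b * Im x + c * Im y)\<^sup>2" for x y
      by (simp add: power2_eq_square algebra_simps)
    with I show ?thesis
      by (elim has_integral_nonneg) simp
  qed
qed

lemmas symbol_bounds = nonneg_quadratic_formD[OF symbol_quadratic_form_nonneg]

section \<open>Positive semidefinite ternary forms and eigenvalue bounds\<close>

text \<open>After multiplication by the product of the three masses, completing the square leaves
  only squares weighted by the univariate gaps between \<open>m * s\<close> and the square of
  \<open>a\<close>.\<close>

lemma product_form_nonneg:
  fixes m\<^sub>1 m\<^sub>2 m\<^sub>3 a\<^sub>1 a\<^sub>2 a\<^sub>3 s\<^sub>1 s\<^sub>2 s\<^sub>3 y\<^sub>1 y\<^sub>2 y\<^sub>3 :: real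
  assumes "0 \<le> m\<^sub>1" "0 \<le> m\<^sub>2" "0 \<le> m\<^sub>3" "0 \<le> s\<^sub>1" "0 \<le> s\<^sub>2" "0 \<le> s\<^sub>3"
    and "a\<^sub>1\<^sup>2 \<le> m\<^sub>1 * s\<^sub>1" "a\<^sub>2\<^sup>2 \<le> m\<^sub>2 * s\<^sub>2" "a\<^sub>3\<^sup>2 \<le> m\<^sub>3 * s\<^sub>3"
  shows "0 \<le> s\<^sub>1 * m\<^sub>2 * m\<^sub>3 * y\<^sub>1\<^sup>2 + m\<^sub>1 * s\<^sub>2 * m\<^sub>3 * y\<^sub>2\<^sup>2 + m\<^sub>1 * m\<^sub>2 * s\<^sub>3 * y\<^sub>3\<^sup>2
    + 2 * (a\<^sub>1 * a\<^sub>2 * m\<^sub>3 * y\<^sub>1 * y\<^sub>2 + a\<^sub>1 * m\<^sub>2 * a\<^sub>3 * y\<^sub>1 * y\<^sub>3 + m\<^sub>1 * a\<^sub>2 * a\<^sub>3 * y\<^sub>2 * y\<^sub>3)"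
    (is "0 \<le> ?Q")
proof (cases "m\<^sub>1 = 0 \<or> m\<^sub>2 = 0 \<or> m\<^sub>3 = 0")
  case True
  \<comment> \<open>A vanishing mass forces the advection value with the same index to vanish, so at
    most one diagonal term survives.\<close>
  then show ?thesis using assms by auto
next
  case False
  then have pos: "0 < m\<^sub>1 * m\<^sub>2 * m\<^sub>3" using assms by (simp add: less_le)
  have "m\<^sub>1 * m\<^sub>2 * m\<^sub>3 * ?Q =
      (a\<^sub>1 * m\<^sub>2 * m\<^sub>3 * y\<^sub>1 + m\<^sub>1 * a\<^sub>2 * m\<^sub>3 * y\<^sub>2 + m\<^sub>1 * m\<^sub>2 * a\<^sub>3 * y\<^sub>3)\<^sup>2
      + (m\<^sub>1 * s\<^sub>1 - a\<^sub>1\<^sup>2) * (m\<^sub>2 * m\<^sub>3 * y\<^sub>1)\<^sup>2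
      + (m\<^sub>2 * s\<^sub>2 - a\<^sub>2\<^sup>2) * (m\<^sub>1 * m\<^sub>3 * y\<^sub>2)\<^sup>2
      + (m\<^sub>3 * s\<^sub>3 - a\<^sub>3\<^sup>2) * (m\<^sub>1 * m\<^sub>2 * y\<^sub>3)\<^sup>2"
    by (simp add: power2_eq_square algebra_simps)
  also have "\<dots> \<ge> 0" using assms by (intro add_nonneg_nonneg mult_nonneg_nonneg) auto
  finally show ?thesis using pos by (simp add: zero_le_mult_iff)
qed

text \<open>The form of a symmetric matrix with diagonal \<open>a\<close>, \<open>b\<close>,
  \<open>c\<close> and entries \<open>d\<close>, \<open>e\<close>, \<open>f\<close> at positions
  (1,2), (1,3), (2,3).\<close>

definition quadratic_form3 :: "real \<Rightarrow> real \<Rightarrow> real \<Rightarrow> real \<Rightarrow> real \<Rightarrow> real \<Rightarrow> real \<Rightarrow> real \<Rightarrow> real \<Rightarrow> real" where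
  "quadratic_form3 a b c d e f x y z =
     a * x\<^sup>2 + b * y\<^sup>2 + c * z\<^sup>2 + 2 * (d * x * y + e * x * z + f * y * z)"

text \<open>Stands in for the fact that the largest eigenvalue of a positive semidefinite matrix is
  at most its trace.\<close>

lemma quadratic_form3_le_trace:
  assumes "\<And>x y z. 0 \<le> quadratic_form3 a b c d e f x y z"
  shows "quadratic_form3 a b c d e f x y z \<le> (a + b + c) * (x\<^sup>2 + y\<^sup>2 + z\<^sup>2)"
proof -
  let ?Q = "quadratic_form3 a b c d e f"
  \<comment> \<open>the rows of the matrix of the cross product with \<open>(x, y, z)\<close>\<close>
  have "(a + b + c) * (x\<^sup>2 + y\<^sup>2 + z\<^sup>2) - ?Q x y z = ?Q 0 z (-y) + ?Q (-z) 0 x + ?Q y (-x) 0"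
    by (simp add: quadratic_form3_def power2_eq_square algebra_simps)
  moreover have "\<dots> \<ge> 0" by (intro add_nonneg_nonneg assms)
  ultimately show ?thesis by linarith
qed

text \<open>A Rayleigh quotient argument: the form of a real symmetric matrix at a complex
  eigenvector is the sum of its values at the real and imaginary parts, hence real.\<close>

lemma eigenvalue_mat3_bounds:
  fixes a b c d e f \<alpha> \<beta> L :: real and A :: "complex mat"
  assumes psd: "\<And>x y z. 0 \<le> quadratic_form3 a b c d e f x y z"
    and L: "L = a + b + c"
    and A: "A = map_mat of_real (mat_of_rows_list 3
      [[\<alpha> * L + (\<beta> - \<alpha>) * a, (\<beta> - \<alpha>) * d, (\<beta> - \<alpha>) * e],
       [(\<beta> - \<alpha>) * d, \<alpha> * L + (\<beta> - \<alpha>) * b, (\<beta> - \<alpha>) * f],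
       [(\<beta> - \<alpha>) * e, (\<beta> - \<alpha>) * f, \<alpha> * L + (\<beta> - \<alpha>) * c]])"
    and ev: "eigenvalue A ev"
  shows "ev \<in> \<real> \<and> min \<alpha> \<beta> * L \<le> Re ev \<and> Re ev \<le> max \<alpha> \<beta> * L"
proof -
  have dim: "dim_row A = 3" "dim_col A = 3"
    by (simp_all add: A mat_of_rows_list_def)
  from ev obtain v where v: "v \<in> carrier_vec 3" "v \<noteq> 0\<^sub>v 3" "A *\<^sub>v v = ev \<cdot>\<^sub>v v"
    unfolding eigenvalue_def eigenvector_def dim by blast
  define x y z where "x = v $ 0" and "y = v $ 1" and "z = v $ 2"
  have row: "(A *\<^sub>v v) $ i = A $$ (i, 0) * x + A $$ (i, 1) * y + A $$ (i, 2) * z" if "i < 3" for i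
    using that v(1) dim
    by (simp add: scalar_prod_def x_def y_def z_def numeral_3_eq_3 lessThan_Suc algebra_simps numeral_2_eq_2)
  have eq: "A $$ (i, 0) * x + A $$ (i, 1) * y + A $$ (i, 2) * z = ev * v $ i" if "i < 3" for i
    using row[OF that] v that by auto
  have ent: "A $$ (0, 0) = of_real (\<alpha> * L + (\<beta> - \<alpha>) * a)" "A $$ (0, 1) = of_real ((\<beta> - \<alpha>) * d)"
    "A $$ (0, 2) = of_real ((\<beta> - \<alpha>) * e)" "A $$ (1, 0) = of_real ((\<beta> - \<alpha>) * d)"
    "A $$ (1, 1) = of_real (\<alpha> * L + (\<beta> - \<alpha>) * b)" "A $$ (1, 2) = of_real ((\<beta> - \<alpha>) * f)"
    "A $$ (2, 0) = of_real ((\<beta> - \<alpha>) * e)" "A $$ (2, 1) = of_real ((\<beta> - \<alpha>) * f)"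
    "A $$ (2, 2) = of_real (\<alpha> * L + (\<beta> - \<alpha>) * c)"
    by (simp_all add: A mat_of_rows_list_def)
  have eqs: "ev * x = of_real (\<alpha> * L + (\<beta> - \<alpha>) * a) * x + of_real ((\<beta> - \<alpha>) * d) * y + of_real ((\<beta> - \<alpha>) * e) * z"
    "ev * y = of_real ((\<beta> - \<alpha>) * d) * x + of_real (\<alpha> * L + (\<beta> - \<alpha>) * b) * y + of_real ((\<beta> - \<alpha>) * f) * z"
    "ev * z = of_real ((\<beta> - \<alpha>) * e) * x + of_real ((\<beta> - \<alpha>) * f) * y + of_real (\<alpha> * L + (\<beta> - \<alpha>) * c) * z"
    using eq[of 0] eq[of 1] eq[of 2] unfolding ent by (simp_all add: x_def y_def z_def)
  define N where "N = ((Re x)\<^sup>2 + (Re y)\<^sup>2 + (Re z)\<^sup>2) + ((Im x)\<^sup>2 + (Im y)\<^sup>2 + (Im z)\<^sup>2)"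
  define Q where "Q = quadratic_form3 a b c d e f (Re x) (Re y) (Re z)
    + quadratic_form3 a b c d e f (Im x) (Im y) (Im z)"
  have "\<not> (x = 0 \<and> y = 0 \<and> z = 0)"
  proof
    assume "x = 0 \<and> y = 0 \<and> z = 0"
    then have "v $ i = 0" if "i < 3" for i
      using that by (auto simp: x_def y_def z_def numeral_3_eq_3 numeral_2_eq_2 less_Suc_eq)
    then have "v = 0\<^sub>v 3" using v(1) by (intro eq_vecI) auto
    with v(2) show False by simp
  qed
  then have N: "N > 0"
    unfolding N_def
    by (metis add_nonneg_nonneg add_nonneg_eq_0_iff complex_eq_iff less_le power_eq_0_iff zero_complex.sel
        zero_le_power2)
  \<comment> \<open>Pairing the eigenvalue equation with the conjugate eigenvector, whose squared
    norm is \<open>N\<close>.\<close>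
  have "ev * of_real N = cnj x * (ev * x) + cnj y * (ev * y) + cnj z * (ev * z)"
    by (simp add: N_def complex_eq_iff power2_eq_square algebra_simps)
  also have "\<dots> = of_real (\<alpha> * L * N + (\<beta> - \<alpha>) * Q)"
    unfolding eqs
    by (simp add: N_def Q_def quadratic_form3_def complex_eq_iff power2_eq_square algebra_simps)
  finally have "ev = of_real ((\<alpha> * L * N + (\<beta> - \<alpha>) * Q) / N)" (is "_ = of_real ?r")
    using N by (simp add: field_simps)
  \<comment> \<open>\<open>?r\<close> is affine in \<open>Q\<close> and runs from
    \<open>\<alpha> * L\<close> at \<open>Q = 0\<close> to \<open>\<beta> * L\<close> at
    \<open>Q = L * N\<close>.\<close>
  moreover have "min \<alpha> \<beta> * L \<le> ?r \<and> ?r \<le> max \<alpha> \<beta> * L"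
  proof -
    have Q: "0 \<le> Q" unfolding Q_def by (intro add_nonneg_nonneg psd)
    have QL: "Q \<le> L * N"
      using add_mono[OF quadratic_form3_le_trace[OF psd] quadratic_form3_le_trace[OF psd]]
      unfolding Q_def N_def L distrib_left[of "a + b + c" "(Re x)\<^sup>2 + (Re y)\<^sup>2 + (Re z)\<^sup>2"] .
    show ?thesis
    proof (cases "\<alpha> \<le> \<beta>")
      case True
      then have "0 \<le> (\<beta> - \<alpha>) * Q" "(\<beta> - \<alpha>) * Q \<le> (\<beta> - \<alpha>) * (L * N)"
        using Q QL by (auto intro: mult_left_mono)
      then show ?thesis
        using True N by (simp add: pos_le_divide_eq pos_divide_le_eq algebra_simps)
    next
      case False
      then have "0 \<le> (\<alpha> - \<beta>) * Q" "(\<alpha> - \<beta>) * Q \<le> (\<alpha> - \<beta>) * (L * N)"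
        using Q QL by (auto intro: mult_left_mono)
      then show ?thesis
        using False N by (simp add: pos_le_divide_eq pos_divide_le_eq algebra_simps)
    qed
  qed
  ultimately show ?thesis by simp
qed

section \<open>Spectrum of the three-dimensional symbol\<close>

theorem theorem5p6:
  fixes p :: nat and \<alpha> \<beta> :: real and \<nu> :: "nat \<Rightarrow> real" and \<theta>\<^sub>1 \<theta>\<^sub>2 \<theta>\<^sub>3 :: real
  assumes "p \<ge> 1"
    and "\<alpha> \<ge> 0" and "\<beta> \<ge> 0"
    and "\<And>i. i \<in> {1, 2, 3} \<Longrightarrow> \<nu> i \<in> \<rat> \<and> \<nu> i > 0"
    and "\<theta>\<^sub>1 \<in> {-pi..pi}" and "\<theta>\<^sub>2 \<in> {-pi..pi}" and "\<theta>\<^sub>3 \<in> {-pi..pi}"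
  shows "0 \<le> min \<alpha> \<beta> * laplacian_symbol p \<nu> \<theta>\<^sub>1 \<theta>\<^sub>2 \<theta>\<^sub>3 \<and>
    (\<forall>ev. eigenvalue (symbol_matrix p \<alpha> \<beta> \<nu> \<theta>\<^sub>1 \<theta>\<^sub>2 \<theta>\<^sub>3) ev \<longrightarrow>
       ev \<in> \<real> \<and>
       min \<alpha> \<beta> * laplacian_symbol p \<nu> \<theta>\<^sub>1 \<theta>\<^sub>2 \<theta>\<^sub>3 \<le> Re ev \<and>
       Re ev \<le> max \<alpha> \<beta> * laplacian_symbol p \<nu> \<theta>\<^sub>1 \<theta>\<^sub>2 \<theta>\<^sub>3)"
proof -
  note sb = symbol_bounds[OF \<open>p \<ge> 1\<close>]
  let ?m = "mass_symbol p" and ?a = "advection_symbol p" and ?s = "stiffness_symbol p"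
  let ?L = "laplacian_symbol p \<nu> \<theta>\<^sub>1 \<theta>\<^sub>2 \<theta>\<^sub>3"
  have \<nu>: "0 < \<nu> 1" "0 < \<nu> 2" "0 < \<nu> 3"
    using assms(4) by auto
  \<comment> \<open>Square roots of the gamma coefficients whose pairwise products are the delta
    coefficients; rescaling the variables by \<open>g\<close> thus absorbs all geometric weights
    into the unweighted form.\<close>
  define g where "g i = \<nu> i / sqrt (\<nu> 1 * \<nu> 2 * \<nu> 3)" for i
  have gamma: "gamma_coeff \<nu> i = (g i)\<^sup>2" for i
    using \<nu> by (simp add: gamma_coeff_def g_def power_divide)
  have delta: "delta_coeff \<nu> 3 = g 1 * g 2" "delta_coeff \<nu> 2 = g 1 * g 3" "delta_coeff \<nu> 1 = g 2 * g 3"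
    using \<nu> by (simp_all add: delta_coeff_def g_def)
  define a b c d e f where
    "a = gamma_coeff \<nu> 1 * ?s \<theta>\<^sub>1 * ?m \<theta>\<^sub>2 * ?m \<theta>\<^sub>3" and
    "b = gamma_coeff \<nu> 2 * ?m \<theta>\<^sub>1 * ?s \<theta>\<^sub>2 * ?m \<theta>\<^sub>3" and
    "c = gamma_coeff \<nu> 3 * ?m \<theta>\<^sub>1 * ?m \<theta>\<^sub>2 * ?s \<theta>\<^sub>3" and
    "d = delta_coeff \<nu> 3 * ?a \<theta>\<^sub>1 * ?a \<theta>\<^sub>2 * ?m \<theta>\<^sub>3" and
    "e = delta_coeff \<nu> 2 * ?a \<theta>\<^sub>1 * ?m \<theta>\<^sub>2 * ?a \<theta>\<^sub>3" and
    "f = delta_coeff \<nu> 1 * ?m \<theta>\<^sub>1 * ?a \<theta>\<^sub>2 * ?a \<theta>\<^sub>3"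
  note defs = a_def b_def c_def d_def e_def f_def
  have psd: "0 \<le> quadratic_form3 a b c d e f x y z" for x y z
  proof -
    have "0 \<le> ?s \<theta>\<^sub>1 * ?m \<theta>\<^sub>2 * ?m \<theta>\<^sub>3 * (g 1 * x)\<^sup>2 + ?m \<theta>\<^sub>1 * ?s \<theta>\<^sub>2 * ?m \<theta>\<^sub>3 * (g 2 * y)\<^sup>2
        + ?m \<theta>\<^sub>1 * ?m \<theta>\<^sub>2 * ?s \<theta>\<^sub>3 * (g 3 * z)\<^sup>2
        + 2 * (?a \<theta>\<^sub>1 * ?a \<theta>\<^sub>2 * ?m \<theta>\<^sub>3 * (g 1 * x) * (g 2 * y)
          + ?a \<theta>\<^sub>1 * ?m \<theta>\<^sub>2 * ?a \<theta>\<^sub>3 * (g 1 * x) * (g 3 * z)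
          + ?m \<theta>\<^sub>1 * ?a \<theta>\<^sub>2 * ?a \<theta>\<^sub>3 * (g 2 * y) * (g 3 * z))"
      by (intro product_form_nonneg sb)
    also have "\<dots> = quadratic_form3 a b c d e f x y z"
      unfolding quadratic_form3_def defs gamma delta by (simp add: power_mult_distrib algebra_simps)
    finally show ?thesis .
  qed
  have L: "?L = a + b + c"
    by (simp add: laplacian_symbol_def Let_def defs)
  \<comment> \<open>On the diagonal, one of the three summands of \<open>?L\<close> carries
    \<open>\<beta>\<close> and the other two carry \<open>\<alpha>\<close>.\<close>
  have "symbol_matrix p \<alpha> \<beta> \<nu> \<theta>\<^sub>1 \<theta>\<^sub>2 \<theta>\<^sub>3 = map_mat of_real (mat_of_rows_list 3
      [[\<alpha> * ?L + (\<beta> - \<alpha>) * a, (\<beta> - \<alpha>) * d, (\<beta> - \<alpha>) * e],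
       [(\<beta> - \<alpha>) * d, \<alpha> * ?L + (\<beta> - \<alpha>) * b, (\<beta> - \<alpha>) * f],
       [(\<beta> - \<alpha>) * e, (\<beta> - \<alpha>) * f, \<alpha> * ?L + (\<beta> - \<alpha>) * c]])"
    unfolding symbol_matrix_def Let_def L defs
    by (intro arg_cong[where f = "map_mat of_real"] arg_cong[where f = "mat_of_rows_list 3"])
       (simp add: algebra_simps)
  moreover have "0 \<le> ?L"
    unfolding L defs gamma by (intro add_nonneg_nonneg mult_nonneg_nonneg sb) auto
  ultimately show ?thesis
    using eigenvalue_mat3_bounds[OF psd L] assms(2,3) by simp
qed

end
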